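(* Let $(\Omega,\Sigma,P_{\mathbb{D}})$ be a $\mathbb{D}$-probabilistic space and let $X_{\mathbb{D}}$ and $Y_{\mathbb{D}}$ be $\mathbb{D}$-random variables on it such that $X_{\mathbb{D}}^2$ and $Y_{\mathbb{D}}^2$ are integrable. Then $$[E(X_{\mathbb{D}}Y_{\mathbb{D}})]^{2}\preceq E(X_{\mathbb{D}}^{2})\,E(Y_{\mathbb{D}}^{2}).$$
   Context: The hyperbolic numbers are the commutative ring $\mathbb{D}=\{a+bk \mid a,b\in\mathbb{R},\ k^2=1,\ k\notin\mathbb{R}\}$. Put $e=\frac{1+k}{2}$, $e^{\dagger}=\frac{1-k}{2}$ (so $e^2=e$, $(e^\dagger)^2=e^\dagger$, $ee^\dagger=0$, $e+e^\dagger=1$); every $z=a+bk$ is uniquely $z=v_1e+v_2e^{\dagger}$ with $v_1=a+b$, $v_2=a-b\in\mathbb{R}$, and all algebraic operations are componentwise in $(v_1,v_2)$. Let $\mathbb{D}^+=\{v_1e+v_2e^\dagger \mid v_1,v_2\ge 0\}$ and write $z_1\preceq z_2$ if $z_2-z_1\in\mathbb{D}^+$. The topology on $\mathbb{D}$ is the usual topology of $\mathbb{R}^2$ in the coordinates $(v_1,v_2)$. A $\mathbb{D}$-probabilistic space $(\Omega,\Sigma,P_{\mathbb{D}})$ is a measurable space $(\Omega,\Sigma)$ with a function $P_{\mathbb{D}}\colon\Sigma\to\mathbb{D}$ such that $P_{\mathbb{D}}(A)\succeq 0$ for all $A\in\Sigma$, $P_{\mathbb{D}}(\Omega)\in\{1,e,e^\dagger\}$,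 and $P_{\mathbb{D}}$ is countably additive on pairwise disjoint sequences in $\Sigma$. Write $P_{\mathbb{D}}=P_1e+P_2e^\dagger$; $P_1,P_2$ are ordinary real measures on $\Sigma$ (each a probability measure or zero). A $\mathbb{D}$-random variable is a function $X_{\mathbb{D}}\colon\Omega\to\mathbb{D}$ with $X_{\mathbb{D}}^{-1}(U)\in\Sigma$ for every open $U\subset\mathbb{D}$; equivalently $X_{\mathbb{D}}=eX_1+e^\dagger X_2$ with $X_1,X_2$ real measurable functions. It is integrable if $X_1$ is Lebesgue integrable with respect to $P_1$ and $X_2$ with respect to $P_2$, and then its expectation is $E(X_{\mathbb{D}})=\int_\Omega X_{\mathbb{D}}\,dP_{\mathbb{D}}=e\int_\Omega X_1\,dP_1+e^\dagger\int_\Omega X_2\,dP_2$. *)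

theory Defs
  imports "HOL-Analysis.Analysis"
begin

section \<open>The hyperbolic numbers\<close>

text \<open>\<open>Hyp a b\<close> is the number \<open>a + b k\<close> with \<open>k\<^sup>2 = 1\<close>.\<close>

datatype hyp = Hyp (hyp_re: real) (hyp_im: real)

instantiation hyp :: comm_ring_1
begin

definition "0 = Hyp 0 0"
definition "1 = Hyp 1 0"
definition "- z = Hyp (- hyp_re z) (- hyp_im z)"
definition "z + w = Hyp (hyp_re z + hyp_re w) (hyp_im z + hyp_im w)"
definition "z - w = Hyp (hyp_re z - hyp_re w) (hyp_im z - hyp_im w)"
definition "z * w = Hyp (hyp_re z * hyp_re w + hyp_im z * hyp_im w)
                        (hyp_re z * hyp_im w + hyp_im z * hyp_re w)"

instance
  by standard
    (auto simp: zero_hyp_def one_hyp_def uminus_hyp_def plus_hyp_def minus_hyp_def times_hyp_def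
      algebra_simps intro: hyp.expand)

end

instantiation hyp :: real_algebra_1
begin

definition "scaleR r z = Hyp (r * hyp_re z) (r * hyp_im z)"

instance
  by standard
    (auto simp: plus_hyp_def times_hyp_def scaleR_hyp_def algebra_simps intro: hyp.expand)

end

definition hyp_k :: hyp where "hyp_k = Hyp 0 1"

definition hyp_e :: hyp where "hyp_e = (1 / 2) *\<^sub>R (1 + hyp_k)"

definition hyp_e_dag :: hyp where "hyp_e_dag = (1 / 2) *\<^sub>R (1 - hyp_k)"

text \<open>The coordinates with respect to the idempotent basis, see \<open>hyp_decomp_iff\<close> below.\<close>

definition hyp_fst :: "hyp \<Rightarrow> real" where "hyp_fst z = hyp_re z + hyp_im z"

definition hyp_snd :: "hyp \<Rightarrow> real" where "hyp_snd z = hyp_re z - hyp_im z"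

lemmas hyp_ring_defs = zero_hyp_def one_hyp_def uminus_hyp_def plus_hyp_def minus_hyp_def
  times_hyp_def scaleR_hyp_def

lemma hyp_k_square: "hyp_k\<^sup>2 = 1"
  by (simp add: hyp_k_def power2_eq_square hyp_ring_defs)

lemma hyp_decomp_iff:
  "z = v1 *\<^sub>R hyp_e + v2 *\<^sub>R hyp_e_dag \<longleftrightarrow> v1 = hyp_fst z \<and> v2 = hyp_snd z"
  by (cases z)
    (auto simp: hyp_e_def hyp_e_dag_def hyp_k_def hyp_fst_def hyp_snd_def hyp_ring_defs field_simps)

lemma hyp_eq_iff: "z = w \<longleftrightarrow> hyp_fst z = hyp_fst w \<and> hyp_snd z = hyp_snd w"
  by (cases z; cases w) (auto simp: hyp_fst_def hyp_snd_def)

lemma hyp_fst_simps [simp]: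
  "hyp_fst 0 = 0" "hyp_fst 1 = 1" "hyp_fst hyp_e = 1" "hyp_fst hyp_e_dag = 0"
  "hyp_fst (- z) = - hyp_fst z" "hyp_fst (z + w) = hyp_fst z + hyp_fst w"
  "hyp_fst (z - w) = hyp_fst z - hyp_fst w" "hyp_fst (z * w) = hyp_fst z * hyp_fst w"
  "hyp_fst (r *\<^sub>R z) = r * hyp_fst z"
  by (auto simp: hyp_fst_def hyp_e_def hyp_e_dag_def hyp_k_def hyp_ring_defs algebra_simps)

lemma hyp_snd_simps [simp]:
  "hyp_snd 0 = 0" "hyp_snd 1 = 1" "hyp_snd hyp_e = 0" "hyp_snd hyp_e_dag = 1"
  "hyp_snd (- z) = - hyp_snd z" "hyp_snd (z + w) = hyp_snd z + hyp_snd w"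
  "hyp_snd (z - w) = hyp_snd z - hyp_snd w" "hyp_snd (z * w) = hyp_snd z * hyp_snd w"
  "hyp_snd (r *\<^sub>R z) = r * hyp_snd z"
  by (auto simp: hyp_snd_def hyp_e_def hyp_e_dag_def hyp_k_def hyp_ring_defs algebra_simps)

definition hyp_nonneg :: "hyp set" where
  "hyp_nonneg = {v1 *\<^sub>R hyp_e + v2 *\<^sub>R hyp_e_dag | v1 v2. v1 \<ge> 0 \<and> v2 \<ge> 0}"

lemma hyp_nonneg_iff: "z \<in> hyp_nonneg \<longleftrightarrow> hyp_fst z \<ge> 0 \<and> hyp_snd z \<ge> 0"
  by (auto simp: hyp_nonneg_def hyp_decomp_iff)

text \<open>The order is partial, not total.\<close>

instantiation hyp :: order
begin

definition less_eq_hyp :: "hyp \<Rightarrow> hyp \<Rightarrow> bool" where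
  "z \<le> w \<longleftrightarrow> w - z \<in> hyp_nonneg"

definition less_hyp :: "hyp \<Rightarrow> hyp \<Rightarrow> bool" where
  "z < w \<longleftrightarrow> z \<le> w \<and> \<not> w \<le> (z :: hyp)"

instance
  by standard (auto simp: less_eq_hyp_def less_hyp_def hyp_nonneg_iff hyp_eq_iff)

end

text \<open>The topology is that of \<open>\<real> \<times> \<real>\<close> in the idempotent coordinates.\<close>

definition hyp_coords :: "hyp \<Rightarrow> real \<times> real" where
  "hyp_coords z = (hyp_fst z, hyp_snd z)"

lemma bij_hyp_coords: "bij hyp_coords"
proof (rule bijI)
  show "inj hyp_coords"
    by (auto simp: inj_def hyp_coords_def hyp_eq_iff)
  have "p = hyp_coords (fst p *\<^sub>R hyp_e + snd p *\<^sub>R hyp_e_dag)" for p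
    by (simp add: hyp_coords_def)
  then show "surj hyp_coords"
    by (rule surjI[OF sym])
qed

instantiation hyp :: topological_space
begin

definition open_hyp :: "hyp set \<Rightarrow> bool" where
  "open U \<longleftrightarrow> open (hyp_coords ` U)"

instance
proof
  show "open (UNIV :: hyp set)"
    using bij_hyp_coords by (simp add: open_hyp_def bij_def)
next
  fix S T :: "hyp set"
  assume "open S" "open T"
  then show "open (S \<inter> T)"
    using bij_hyp_coords by (auto simp: open_hyp_def bij_def image_Int)
next
  fix K :: "hyp set set"
  assume "\<forall>S\<in>K. open S"
  then show "open (\<Union>K)"
    by (auto simp: open_hyp_def image_Union)
qed

end

section \<open>Hyperbolic probability\<close>

locale hyp_prob_space = sigma_algebra \<Omega> \<A>
  for \<Omega> :: "'a set" and \<A> :: "'a set set" +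
  fixes P :: "'a set \<Rightarrow> hyp"
  assumes P_nonneg: "A \<in> \<A> \<Longrightarrow> P A \<ge> 0"
    and P_space: "P \<Omega> \<in> {1, hyp_e, hyp_e_dag}"
    and P_countably_additive:
      "range B \<subseteq> \<A> \<Longrightarrow> disjoint_family B \<Longrightarrow> (\<lambda>i::nat. P (B i)) sums P (\<Union>i. B i)"

definition hyp_random_variable :: "'a set \<Rightarrow> 'a set set \<Rightarrow> ('a \<Rightarrow> hyp) \<Rightarrow> bool" where
  "hyp_random_variable \<Omega> \<A> X \<longleftrightarrow> (\<forall>U. open U \<longrightarrow> X -` U \<inter> \<Omega> \<in> \<A>)"

text \<open>The component measures of \<open>P\<close>; that they take the expected values on \<open>\<A>\<close> is
  shown in \<open>emeasure_hyp_measure\<close> below.\<close>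

definition hyp_measure1 :: "'a set \<Rightarrow> 'a set set \<Rightarrow> ('a set \<Rightarrow> hyp) \<Rightarrow> 'a measure" where
  "hyp_measure1 \<Omega> \<A> P = measure_of \<Omega> \<A> (\<lambda>A. ennreal (hyp_fst (P A)))"

definition hyp_measure2 :: "'a set \<Rightarrow> 'a set set \<Rightarrow> ('a set \<Rightarrow> hyp) \<Rightarrow> 'a measure" where
  "hyp_measure2 \<Omega> \<A> P = measure_of \<Omega> \<A> (\<lambda>A. ennreal (hyp_snd (P A)))"

definition hyp_integrable ::
    "'a set \<Rightarrow> 'a set set \<Rightarrow> ('a set \<Rightarrow> hyp) \<Rightarrow> ('a \<Rightarrow> hyp) \<Rightarrow> bool" where
  "hyp_integrable \<Omega> \<A> P X \<longleftrightarrow>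
     integrable (hyp_measure1 \<Omega> \<A> P) (\<lambda>\<omega>. hyp_fst (X \<omega>)) \<and>
     integrable (hyp_measure2 \<Omega> \<A> P) (\<lambda>\<omega>. hyp_snd (X \<omega>))"

definition hyp_expectation ::
    "'a set \<Rightarrow> 'a set set \<Rightarrow> ('a set \<Rightarrow> hyp) \<Rightarrow> ('a \<Rightarrow> hyp) \<Rightarrow> hyp" where
  "hyp_expectation \<Omega> \<A> P X =
     (\<integral>\<omega>. hyp_fst (X \<omega>) \<partial>hyp_measure1 \<Omega> \<A> P) *\<^sub>R hyp_e +
     (\<integral>\<omega>. hyp_snd (X \<omega>) \<partial>hyp_measure2 \<Omega> \<A> P) *\<^sub>R hyp_e_dag"

lemma continuous_on_hyp_coords: "continuous_on UNIV hyp_coords"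
proof -
  have "surj hyp_coords"
    using bij_hyp_coords by (rule bij_is_surj)
  then have "open (hyp_coords -` B)" if "open B" for B
    using that by (simp only: open_hyp_def surj_image_vimage_eq)
  then show ?thesis
    by (simp add: continuous_on_open_vimage)
qed

lemma continuous_on_hyp_fst: "continuous_on UNIV hyp_fst"
  and continuous_on_hyp_snd: "continuous_on UNIV hyp_snd"
  using continuous_on_fst[OF continuous_on_hyp_coords] continuous_on_snd[OF continuous_on_hyp_coords]
  by (simp_all add: hyp_coords_def)

lemma tendsto_hyp_fst: "(f \<longlongrightarrow> z) F \<Longrightarrow> ((\<lambda>x. hyp_fst (f x)) \<longlongrightarrow> hyp_fst z) F"
  and tendsto_hyp_snd: "(f \<longlongrightarrow> z) F \<Longrightarrow> ((\<lambda>x. hyp_snd (f x)) \<longlongrightarrow> hyp_snd z) F"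
  by (auto intro: continuous_on_tendsto_compose[OF continuous_on_hyp_fst]
      continuous_on_tendsto_compose[OF continuous_on_hyp_snd])

lemma hyp_fst_sum: "hyp_fst (sum f A) = (\<Sum>x\<in>A. hyp_fst (f x))"
  and hyp_snd_sum: "hyp_snd (sum f A) = (\<Sum>x\<in>A. hyp_snd (f x))"
  by (induction A rule: infinite_finite_induct; simp)+

lemma (in sigma_algebra) emeasure_measure_of_sums:
  fixes \<mu> :: "'a set \<Rightarrow> real"
  assumes nonneg: "\<And>A. A \<in> M \<Longrightarrow> \<mu> A \<ge> 0"
    and sums: "\<And>A :: nat \<Rightarrow> 'a set. range A \<subseteq> M \<Longrightarrow> disjoint_family A \<Longrightarrow>
                 (\<lambda>i. \<mu> (A i)) sums \<mu> (\<Union>i. A i)"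
    and "A \<in> M"
  shows "emeasure (measure_of \<Omega> M (\<lambda>A. ennreal (\<mu> A))) A = ennreal (\<mu> A)"
proof (rule emeasure_measure_of_sigma)
  show "sigma_algebra \<Omega> M" by (rule sigma_algebra_axioms)
  show "A \<in> M" by fact
  have "(\<lambda>i::nat. \<mu> {}) sums \<mu> {}"
    using sums[of "\<lambda>_. {}"] by (simp add: disjoint_family_on_def)
  then have "\<mu> {} = 0"
    by (metis sums_summable summable_const_iff)
  then show "positive M (\<lambda>A. ennreal (\<mu> A))"
    by (simp add: positive_def)
  show "countably_additive M (\<lambda>A. ennreal (\<mu> A))"
  proof (rule countably_additiveI)
    fix B :: "nat \<Rightarrow> 'a set"
    assume B: "range B \<subseteq> M" "disjoint_family B"
    then show "(\<Sum>i. ennreal (\<mu> (B i))) = ennreal (\<mu> (\<Union>i. B i))"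
      using nonneg sums[OF B] by (intro suminf_ennreal_eq) auto
  qed
qed

lemma (in hyp_prob_space) emeasure_hyp_measure:
  assumes "A \<in> \<A>"
  shows "emeasure (hyp_measure1 \<Omega> \<A> P) A = ennreal (hyp_fst (P A))"
    and "emeasure (hyp_measure2 \<Omega> \<A> P) A = ennreal (hyp_snd (P A))"
proof -
  have nonneg: "hyp_fst (P B) \<ge> 0" "hyp_snd (P B) \<ge> 0" if "B \<in> \<A>" for B
    using P_nonneg[OF that] by (auto simp: less_eq_hyp_def hyp_nonneg_iff)
  have sums: "(\<lambda>i. hyp_fst (P (B i))) sums hyp_fst (P (\<Union>i. B i))"
    "(\<lambda>i. hyp_snd (P (B i))) sums hyp_snd (P (\<Union>i. B i))"
    if "range B \<subseteq> \<A>" "disjoint_family B" for B :: "nat \<Rightarrow> 'a set"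
    using P_countably_additive[OF that] tendsto_hyp_fst tendsto_hyp_snd
    by (fastforce simp: sums_def hyp_fst_sum hyp_snd_sum)+
  show "emeasure (hyp_measure1 \<Omega> \<A> P) A = ennreal (hyp_fst (P A))"
    unfolding hyp_measure1_def
    by (rule emeasure_measure_of_sums[where \<mu> = "\<lambda>A. hyp_fst (P A)"]) (use nonneg sums assms in auto)
  show "emeasure (hyp_measure2 \<Omega> \<A> P) A = ennreal (hyp_snd (P A))"
    unfolding hyp_measure2_def
    by (rule emeasure_measure_of_sums[where \<mu> = "\<lambda>A. hyp_snd (P A)"]) (use nonneg sums assms in auto)
qed

end

theory Submission
  imports Defs
begin

text \<open>In the idempotent coordinates \<open>hyp_fst\<close> and \<open>hyp_snd\<close>,
  products, expectation and order are all componentwise (\<open>hyp_le_iff\<close> for the order).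
  The claim thus splits into two real Cauchy-Schwarz inequalities, one for each component measure of
  \<open>P\<close>. The real inequality, \<open>Cauchy_Schwarz_integral\<close>, holds because the
  integral of \<open>(a * f x + b * g x)\<^sup>2\<close> is a nonnegative quadratic form in
  \<open>a\<close> and \<open>b\<close>, which bounds its discriminant.\<close>

text \<open>The product is dominated by the sum of the squares (AM-GM). This ensures that the
  integral of the product is not merely the default value 0.\<close>

lemma integrable_mult_of_squares:
  fixes f g :: "'a \<Rightarrow> real"
  assumes [measurable]: "f \<in> borel_measurable M" "g \<in> borel_measurable M"
    and f: "integrable M (\<lambda>x. (f x)\<^sup>2)" and g: "integrable M (\<lambda>x. (g x)\<^sup>2)"
  shows "integrable M (\<lambda>x. f x * g x)"
proof (rule Bochner_Integration.integrable_bound)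
  show "integrable M (\<lambda>x. (f x)\<^sup>2 + (g x)\<^sup>2)"
    using f g by simp
  have "\<bar>f x * g x\<bar> \<le> (f x)\<^sup>2 + (g x)\<^sup>2" for x
  proof -
    have "2 * (\<bar>f x\<bar> * \<bar>g x\<bar>) \<le> (f x)\<^sup>2 + (g x)\<^sup>2"
      using sum_squares_bound[of "\<bar>f x\<bar>" "\<bar>g x\<bar>"] by simp
    moreover have "0 \<le> \<bar>f x\<bar> * \<bar>g x\<bar>"
      by simp
    ultimately show ?thesis
      unfolding abs_mult by linarith
  qed
  then show "AE x in M. norm (f x * g x) \<le> norm ((f x)\<^sup>2 + (g x)\<^sup>2)"
    by simp
qed simp

lemma discriminant_le_if_quadratic_form_nonneg:
  fixes A B C :: real
  assumes form: "\<And>a b. 0 \<le> a\<^sup>2 * A + 2 * a * b * C + b\<^sup>2 * B"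
  shows "C\<^sup>2 \<le> A * B"
proof -
  have A: "0 \<le> A" and B: "0 \<le> B"
    using form[of 1 0] form[of 0 1] by simp_all
  show ?thesis
  proof (cases "A = 0 \<and> B = 0")
    case True
    \<comment> \<open>The form is now \<open>2 * a * b * C\<close>; both signs of
      \<open>a * b\<close> force \<open>C = 0\<close>.\<close>
    then show ?thesis
      using form[of 1 1] form[of 1 "-1"] by simp
  next
    case False
    \<comment> \<open>At \<open>(- C, A)\<close> and \<open>(B, - C)\<close> the form factors as
      shown; whichever of \<open>A\<close>, \<open>B\<close> is positive can be cancelled.\<close>
    have "0 \<le> A * (A * B - C\<^sup>2)" "0 \<le> B * (A * B - C\<^sup>2)"
      using form[of "- C" A] form[of B "- C"] by (simp_all add: algebra_simps power2_eq_square)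
    then show ?thesis
      using A B False by (auto simp: zero_le_mult_iff)
  qed
qed

lemma Cauchy_Schwarz_integral:
  fixes f g :: "'a \<Rightarrow> real"
  assumes meas: "f \<in> borel_measurable M" "g \<in> borel_measurable M"
    and f: "integrable M (\<lambda>x. (f x)\<^sup>2)" and g: "integrable M (\<lambda>x. (g x)\<^sup>2)"
  shows "(\<integral>x. f x * g x \<partial>M)\<^sup>2 \<le> (\<integral>x. (f x)\<^sup>2 \<partial>M) * (\<integral>x. (g x)\<^sup>2 \<partial>M)"
proof (rule discriminant_le_if_quadratic_form_nonneg)
  fix a b :: real
  note fg = integrable_mult_of_squares[OF meas f g]
  have "0 \<le> (\<integral>x. (a * f x + b * g x)\<^sup>2 \<partial>M)"
    by simp
  also have "\<dots> = (\<integral>x. a\<^sup>2 * (f x)\<^sup>2 + 2 * a * b * (f x * g x) + b\<^sup>2 * (g x)\<^sup>2 \<partial>M)"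
    by (simp add: power2_sum power_mult_distrib algebra_simps)
  \<comment> \<open>Linearity of the integral needs the mixed term integrable, which is
    \<open>fg\<close>.\<close>
  also have "\<dots> = a\<^sup>2 * (\<integral>x. (f x)\<^sup>2 \<partial>M) + 2 * a * b * (\<integral>x. f x * g x \<partial>M)
      + b\<^sup>2 * (\<integral>x. (g x)\<^sup>2 \<partial>M)"
    using f g fg by simp
  finally show "0 \<le> a\<^sup>2 * (\<integral>x. (f x)\<^sup>2 \<partial>M) + 2 * a * b * (\<integral>x. f x * g x \<partial>M)
      + b\<^sup>2 * (\<integral>x. (g x)\<^sup>2 \<partial>M)" .
qed

lemma hyp_fst_power [simp]: "hyp_fst (z ^ n) = hyp_fst z ^ n"
  and hyp_snd_power [simp]: "hyp_snd (z ^ n) = hyp_snd z ^ n"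
  by (induction n) simp_all

context sigma_algebra
begin

text \<open>Preimages of open sets under \<open>c\<close> are open in \<open>hyp\<close>, where
  \<open>X\<close> is measurable by definition. Only the measurable sets matter, so
  \<open>\<mu>\<close> is arbitrary and one lemma serves both component measures.\<close>

lemma borel_measurable_comp_hyp_random_variable:
  assumes X: "hyp_random_variable \<Omega> M X" and c: "continuous_on UNIV c"
  shows "(\<lambda>\<omega>. c (X \<omega>)) \<in> borel_measurable (measure_of \<Omega> M \<mu>)"
proof (rule borel_measurableI)
  fix S :: "'b set"
  assume "open S"
  then have "open (c -` S)"
    using c by (simp add: continuous_on_open_vimage)
  then have "X -` (c -` S) \<inter> \<Omega> \<in> M"
    using X by (simp add: hyp_random_variable_def)
  then show "(\<lambda>\<omega>. c (X \<omega>)) -` S \<inter> space (measure_of \<Omega> M \<mu>) \<in> sets (measure_of \<Omega> M \<mu>)"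
    using space_closed by (simp add: space_measure_of_conv vimage_def)
qed

lemma measurable_hyp_components:
  assumes "hyp_random_variable \<Omega> M X"
  shows "(\<lambda>\<omega>. hyp_fst (X \<omega>)) \<in> borel_measurable (hyp_measure1 \<Omega> M P)"
    and "(\<lambda>\<omega>. hyp_snd (X \<omega>)) \<in> borel_measurable (hyp_measure2 \<Omega> M P)"
  unfolding hyp_measure1_def hyp_measure2_def
  using assms continuous_on_hyp_fst continuous_on_hyp_snd
  by (blast intro: borel_measurable_comp_hyp_random_variable)+

end

lemma hyp_le_iff: "z \<le> w \<longleftrightarrow> hyp_fst z \<le> hyp_fst w \<and> hyp_snd z \<le> hyp_snd w"
  by (simp add: less_eq_hyp_def hyp_nonneg_iff)

theorem mainTheorem4:
  fixes \<Omega> :: "'a set" and \<A> :: "'a set set" and P :: "'a set \<Rightarrow> hyp"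
    and X Y :: "'a \<Rightarrow> hyp"
  assumes "hyp_prob_space \<Omega> \<A> P"
    and "hyp_random_variable \<Omega> \<A> X"
    and "hyp_random_variable \<Omega> \<A> Y"
    and "hyp_integrable \<Omega> \<A> P (\<lambda>\<omega>. (X \<omega>)\<^sup>2)"
    and "hyp_integrable \<Omega> \<A> P (\<lambda>\<omega>. (Y \<omega>)\<^sup>2)"
  shows "hyp_integrable \<Omega> \<A> P (\<lambda>\<omega>. X \<omega> * Y \<omega>) \<and>
    (hyp_expectation \<Omega> \<A> P (\<lambda>\<omega>. X \<omega> * Y \<omega>))\<^sup>2
      \<le> hyp_expectation \<Omega> \<A> P (\<lambda>\<omega>. (X \<omega>)\<^sup>2) * hyp_expectation \<Omega> \<A> P (\<lambda>\<omega>. (Y \<omega>)\<^sup>2)"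
proof -
  interpret hyp_prob_space \<Omega> \<A> P
    by fact
  \<comment> \<open>Measurability has to come from \<open>X\<close> and \<open>Y\<close> themselves:
    that of their squares would not determine it, as signs are lost.\<close>
  note meas = measurable_hyp_components[OF assms(2)] measurable_hyp_components[OF assms(3)]
  show ?thesis
    using assms(4,5) meas
    by (simp add: hyp_integrable_def hyp_expectation_def hyp_le_iff
        integrable_mult_of_squares Cauchy_Schwarz_integral)
qed

end
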